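(* Let $H,A,\alpha,\sigma,S,\mathfrak{C},U,V,\mathfrak{I},\partial\mathfrak{I}$ be as in the context, let $R:=\langle\sigma^2(\mathfrak{I})\rangle\subset L(V)$, $\mathcal{K}:=S^{-1}(V)\cap R\subset L(V)$ and $\mathcal{L}:=L(V,\mathcal{K})\subset L(V,L(V))$. Suppose that $\mathfrak{I}\subset\mathcal{D}(A)$ and that for each $g\in\partial\mathfrak{I}$ we have $\beta(g+v)-\beta(g)\in V$ for all $v\in\mathfrak{C}\oplus U$. Then: (1) For each $v\in\mathfrak{C}\oplus U$ the mapping $g\mapsto\sigma_g^2(v):\partial\mathfrak{I}\to L(V)$ is constant modulo $\mathcal{K}$. (2) If for each $g\in\partial\mathfrak{I}$ the mapping $v\mapsto\sigma(g+v):\mathfrak{C}\oplus U\to V^n$ is square-affine, then the mapping $g\mapsto\sigma_g^2:\partial\mathfrak{I}\to L(V,L(V))$ is constant modulo $\mathcal{L}$. Here $\sigma_g^2(v):=\sigma^2(g+v)-\sigma^2(g)$.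
   Context: Setting. $H$ is a separable Hilbert space, $A:\mathcal{D}(A)\subset H\to H$ is the generator of a $C_0$-semigroup, $\alpha:H\to H$ and $\sigma=(\sigma_1,\dots,\sigma_n):H\to H^n$ are continuous, and $\beta:=A+\alpha:\mathcal{D}(A)\to H$. $\langle\cdot\rangle$ is linear span. Cone and inner product. $\mathfrak{C}\subset H$ is a finite dimensional proper convex cone, i.e. $\mathfrak{C}=\langle\lambda_1,\dots,\lambda_m\rangle^+:=\{\sum_i a_i\lambda_i:a_i\ge0\}$ with linearly independent $\lambda_i$, $m\ge0$; $C=\langle\mathfrak{C}\rangle$; $U\subset H$ is a finite dimensional subspace with $C\cap U=\{0\}$; $V=C\oplus U$, $\dim V\ge1$. Normalizing $\|\lambda_i\|_H=1$, the inner product on $V$ is $\langle c_1+u_1,c_2+u_2\rangle_V:=\sum_i a_ib_i+\langle u_1,u_2\rangle_H$ for $c_1=\sum a_i\lambda_i$, $c_2=\sum b_i\lambda_i$, $u_1,u_2\in U$. For $s\in V^n$ let $\hat s\in L(\mathbb{R}^n,V)$, $\hat s e_k=s_k$, and $s^2:=\hat s\hat s^*\in L(V)$ (adjoint with respect to the standard inner product on $\mathbb{R}^n$ and $\langle\cdot,\cdot\rangle_V$); $\sigma^2(h):=(\sigma(h))^2$. A map on $\mathfrak{C}\oplus U$ into a vector space is affine if it is the restriction of a constant plus a linear map on $V$; a $V^n$-valued map $s$ is square-affine if $v\mapsto s(v)^2$ is affine. When $v\mapsto\sigma(g+v)$ is square-affine on $\mathfrak{C}\oplus U$, $\sigma_g^2$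 is identified with its unique linear extension in $L(V,L(V))$. Initial points. $\mathfrak{I}\subset H$ is a nonempty set with a decomposition $\mathfrak{I}=\partial\mathfrak{I}\oplus\mathfrak{C}\oplus U$, $\partial\mathfrak{I}\subset H$, such that $H=G\oplus V$ with $G:=\overline{\langle\partial\mathfrak{I}\rangle}$. Standing assumption on the drift. $\sigma(H)\subset V^n$, $\sigma^2:H\to L(V)$ is Lipschitz continuous, and $\alpha=S\sigma^2$ for a linear operator $S\in L(L(V),H)$ with $\mathrm{ran}(S)\subset\mathcal{D}(A)$. A map $f$ into a vector space $Y$ is constant modulo a subspace $Z\subset Y$ if $f(g_1)-f(g_2)\in Z$ for all $g_1,g_2$ in its domain. *)

theory Defs
  imports "HOL-Analysis.Analysis" "HOL-Library.Set_Algebras"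
begin

definition C0_semigroup :: "(real \<Rightarrow> 'h::real_normed_vector \<Rightarrow>\<^sub>L 'h) \<Rightarrow> bool" where
  "C0_semigroup T \<longleftrightarrow>
     T 0 = id_blinfun \<and>
     (\<forall>s\<ge>0. \<forall>t\<ge>0. T (s + t) = T s o\<^sub>L T t) \<and>
     (\<forall>x. ((\<lambda>t. blinfun_apply (T t) x) \<longlongrightarrow> x) (at_right 0))"

text \<open>An unbounded operator is a pair of a domain and a total function; only the values of the
  function on the domain are relevant.\<close>

definition generates_C0_semigroup :: "'h::real_normed_vector set \<Rightarrow> ('h \<Rightarrow> 'h) \<Rightarrow> bool" where
  "generates_C0_semigroup D A \<longleftrightarrow>
     (\<exists>T. C0_semigroup T \<and>
        D = {x. \<exists>y. ((\<lambda>t. (blinfun_apply (T t) x - x) /\<^sub>R t) \<longlongrightarrow> y) (at_right 0)} \<and>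
        (\<forall>x\<in>D. ((\<lambda>t. (blinfun_apply (T t) x - x) /\<^sub>R t) \<longlongrightarrow> A x) (at_right 0)))"

definition convex_cone_gen :: "'h::real_vector set \<Rightarrow> 'h set" where
  "convex_cone_gen \<Lambda> = {\<Sum>l\<in>\<Lambda>. a l *\<^sub>R l | a. \<forall>l\<in>\<Lambda>. 0 \<le> a l}"

text \<open>\<open>X\<close> and \<open>Y\<close> may be arbitrary sets, e.g. sets of boundary points or cones.\<close>

definition direct_sum :: "'h::ab_group_add set \<Rightarrow> 'h set \<Rightarrow> 'h set \<Rightarrow> bool" where
  "direct_sum Z X Y \<longleftrightarrow> bij_betw (\<lambda>(x, y). x + y) (X \<times> Y) Z"

text \<open>
  The finite-dimensional space \<open>V = \<langle>\<Lambda>\<rangle> \<oplus> U\<close> carries an inner product of its own, different from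
  the one of the ambient space. It is represented by a type \<open>'v\<close> of class \<open>euclidean_space\<close>, whose
  inner product is the one of \<open>V\<close>, together with the inclusion map \<open>\<iota>\<close> into the ambient space.
  Consequently \<open>L(V)\<close> is the type \<open>'v \<Rightarrow>\<^sub>L 'v\<close>, \<open>L(V, L(V))\<close> is \<open>'v \<Rightarrow>\<^sub>L 'v \<Rightarrow>\<^sub>L 'v\<close>, and adjoints
  are taken with respect to the inner product of \<open>V\<close>.
\<close>

definition V_inclusion ::
    "'h::real_inner set \<Rightarrow> 'h set \<Rightarrow> ('v::euclidean_space \<Rightarrow> 'h) \<Rightarrow> bool" where
  "V_inclusion \<Lambda> U \<iota> \<longleftrightarrow>
     linear \<iota> \<and> inj \<iota> \<and> range \<iota> = span \<Lambda> + U \<and>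
     (\<forall>a b. \<forall>u\<in>U. \<forall>w\<in>U. \<forall>x y.
        \<iota> x = (\<Sum>l\<in>\<Lambda>. a l *\<^sub>R l) + u \<longrightarrow> \<iota> y = (\<Sum>l\<in>\<Lambda>. b l *\<^sub>R l) + w \<longrightarrow>
        inner x y = (\<Sum>l\<in>\<Lambda>. a l * b l) + inner u w)"

definition to_V :: "('v \<Rightarrow> 'h) \<Rightarrow> 'h ^ 'n \<Rightarrow> 'v ^ 'n" where
  "to_V \<iota> s = (\<chi> k. inv \<iota> (s $ k))"

definition hat :: "'v::euclidean_space ^ 'n \<Rightarrow> real ^ 'n \<Rightarrow> 'v" where
  "hat s x = (\<Sum>k\<in>UNIV. x $ k *\<^sub>R s $ k)"

definition square :: "'v::euclidean_space ^ 'n \<Rightarrow> 'v \<Rightarrow>\<^sub>L 'v" where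
  "square s = Blinfun (hat s \<circ> adjoint (hat s))"

lemma linear_hat: "linear (hat s)"
  unfolding hat_def by (intro linearI) (simp_all add: algebra_simps sum.distrib scaleR_sum_right)

lemma hat_axis: "hat s (axis k 1) = s $ k"
  by (simp add: hat_def axis_def if_distrib[where f = "\<lambda>c. c *\<^sub>R _"] cong: if_cong)

lemma blinfun_apply_square: "blinfun_apply (square s) = hat s \<circ> adjoint (hat s)"
  unfolding square_def
  by (intro bounded_linear_Blinfun_apply linear_conv_bounded_linear[THEN iffD1]
      linear_compose adjoint_linear linear_hat)

text \<open>The vector space \<open>V\<close> of the text is the whole type \<open>'v\<close> here.\<close>

definition affine_map_on :: "'v::real_vector set \<Rightarrow> ('v \<Rightarrow> 'y::real_vector) \<Rightarrow> bool" where
  "affine_map_on X f \<longleftrightarrow> (\<exists>c T. linear T \<and> (\<forall>v\<in>X. f v = c + T v))"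

definition square_affine_on :: "'v::euclidean_space set \<Rightarrow> ('v \<Rightarrow> 'v ^ 'n) \<Rightarrow> bool" where
  "square_affine_on X s \<longleftrightarrow> affine_map_on X (\<lambda>v. square (s v))"

definition linear_extension ::
    "'v::euclidean_space set \<Rightarrow> ('v \<Rightarrow> 'y::real_normed_vector) \<Rightarrow> 'v \<Rightarrow>\<^sub>L 'y" where
  "linear_extension X f = (THE T. \<forall>v\<in>X. blinfun_apply T v = f v)"

lemma linear_extension_eq:
  assumes "span X = UNIV" "\<And>v. v \<in> X \<Longrightarrow> blinfun_apply T v = f v"
  shows "linear_extension X f = T"
  unfolding linear_extension_def
proof (rule the_equality)
  fix T' assume T': "\<forall>v\<in>X. blinfun_apply T' v = f v"
  show "T' = T"
  proof (rule blinfun_eqI)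
    fix v
    have "v \<in> span X" using assms(1) by simp
    then show "blinfun_apply T' v = blinfun_apply T v"
      by (rule linear_eq_on[OF blinfun.bounded_linear_right[THEN bounded_linear.linear]
            blinfun.bounded_linear_right[THEN bounded_linear.linear]]) (simp add: T' assms(2))
  qed
qed (simp add: assms(2))

definition constant_modulo :: "('g \<Rightarrow> 'y::minus) \<Rightarrow> 'g set \<Rightarrow> 'y set \<Rightarrow> bool" where
  "constant_modulo f X Z \<longleftrightarrow> (\<forall>g1\<in>X. \<forall>g2\<in>X. f g1 - f g2 \<in> Z)"

end

theory Submission
  imports Defs
begin

text \<open>
  The generator \<open>A\<close> is linear, so for \<open>g\<close> and \<open>g + v\<close> in its domain the increment
  \<open>A (g + v) - A g\<close> depends on \<open>v\<close> alone. Subtracting the tangency conditions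
  \<open>\<beta> (g + v) - \<beta> g \<in> V\<close> at two boundary points \<open>g\<^sub>1\<close>, \<open>g\<^sub>2\<close> therefore cancels the contribution
  of \<open>A\<close>, and what remains says that \<open>S\<close> maps the difference of the increments of \<open>\<sigma>\<^sup>2\<close> at
  \<open>g\<^sub>1\<close> and \<open>g\<^sub>2\<close> into \<open>V\<close>. These increments also lie in the span \<open>R\<close> of the values of
  \<open>\<sigma>\<^sup>2\<close> on \<open>I\<close>, since both \<open>g\<close> and \<open>g + v\<close> belong to \<open>I\<close>. This is the first claim.

  For the second claim, \<open>\<CC> + U\<close> spans \<open>V\<close> because every element of \<open>\<langle>\<Lambda>\<rangle>\<close> is a difference of
  two elements of the cone. Hence the increments of a square-affine map have a linear extension, and
  two such extensions differ by an operator that maps a spanning set into the subspace \<open>K\<close>, hence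
  everything into \<open>K\<close>.
\<close>

text \<open>
  Both sides are the derivative of the orbit of \<open>v\<close> at \<open>0\<close>: the difference quotients are linear in
  the starting point, and limits are unique.
\<close>

lemma generator_increment_eq:
  assumes "generates_C0_semigroup D A"
    and "x \<in> D" "x + v \<in> D" "y \<in> D" "y + v \<in> D"
  shows "A (x + v) - A x = A (y + v) - A y"
proof -
  obtain T where lim: "\<And>x. x \<in> D \<Longrightarrow>
      ((\<lambda>t. (blinfun_apply (T t) x - x) /\<^sub>R t) \<longlongrightarrow> A x) (at_right 0)"
    using assms(1) unfolding generates_C0_semigroup_def by auto
  have orbit: "((\<lambda>t. (blinfun_apply (T t) v - v) /\<^sub>R t) \<longlongrightarrow> A (z + v) - A z) (at_right 0)"
    if "z \<in> D" "z + v \<in> D" for z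
    using tendsto_diff[OF lim[OF that(2)] lim[OF that(1)]]
    by (simp add: blinfun.add_right algebra_simps)
  show ?thesis
    by (rule tendsto_unique[OF trivial_limit_at_right_real orbit orbit]) (use assms in auto)
qed

lemma zero_in_convex_cone_gen: "0 \<in> convex_cone_gen \<Lambda>"
  unfolding convex_cone_gen_def by (auto intro!: exI[of _ "\<lambda>_. 0"])

lemma convex_cone_gen_subset_span: "convex_cone_gen \<Lambda> \<subseteq> span \<Lambda>"
  unfolding convex_cone_gen_def by (auto intro: span_sum span_scale span_base)

text \<open>The coefficients are split into their positive and negative parts.\<close>

lemma span_eq_cone_difference:
  assumes "finite \<Lambda>" "c \<in> span \<Lambda>"
  obtains p q where "p \<in> convex_cone_gen \<Lambda>" "q \<in> convex_cone_gen \<Lambda>" "c = p - q"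
proof -
  obtain a where c: "c = (\<Sum>l\<in>\<Lambda>. a l *\<^sub>R l)"
    using assms span_finite by auto
  show ?thesis
  proof (rule that)
    show "(\<Sum>l\<in>\<Lambda>. max (a l) 0 *\<^sub>R l) \<in> convex_cone_gen \<Lambda>"
      "(\<Sum>l\<in>\<Lambda>. max (- a l) 0 *\<^sub>R l) \<in> convex_cone_gen \<Lambda>"
      unfolding convex_cone_gen_def by (rule CollectI, rule exI, rule conjI[OF refl], simp)+
    show "c = (\<Sum>l\<in>\<Lambda>. max (a l) 0 *\<^sub>R l) - (\<Sum>l\<in>\<Lambda>. max (- a l) 0 *\<^sub>R l)"
      unfolding c sum_subtractf[symmetric] scaleR_diff_left[symmetric]
      by (intro sum.cong) (auto simp: max_def)
  qed
qed

text \<open>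
  Writing \<open>\<iota> w = (p - q) + u\<close> with \<open>p\<close>, \<open>q\<close> in the cone and \<open>u \<in> U\<close> exhibits \<open>w\<close> as the difference
  of the preimages of \<open>p + u\<close> and \<open>q\<close>.
\<close>

lemma span_vimage_cone_plus_subspace:
  fixes \<iota> :: "'v::euclidean_space \<Rightarrow> 'h::real_inner"
  assumes "finite \<Lambda>" "subspace U" "linear \<iota>" "inj \<iota>" "range \<iota> = span \<Lambda> + U"
  shows "span (\<iota> -` (convex_cone_gen \<Lambda> + U)) = UNIV"
proof -
  have "w \<in> span (\<iota> -` (convex_cone_gen \<Lambda> + U))" for w
  proof -
    have "\<iota> w \<in> span \<Lambda> + U" using assms(5) by blast
    then obtain c u where cu: "\<iota> w = c + u" "c \<in> span \<Lambda>" "u \<in> U"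
      by (auto elim: set_plus_elim)
    obtain p q where pq: "p \<in> convex_cone_gen \<Lambda>" "q \<in> convex_cone_gen \<Lambda>" "c = p - q"
      using span_eq_cone_difference[OF assms(1) cu(2)] .
    have W: "p + u \<in> convex_cone_gen \<Lambda> + U" "q + 0 \<in> convex_cone_gen \<Lambda> + U"
      using pq cu subspace_0[OF assms(2)] by (blast intro: set_plus_intro)+
    moreover have "convex_cone_gen \<Lambda> + U \<subseteq> range \<iota>"
      unfolding assms(5) by (intro set_plus_mono2 convex_cone_gen_subset_span order_refl)
    ultimately obtain x y where xy: "\<iota> x = p + u" "\<iota> y = q"
      by (metis add_0_right imageE subsetD)
    have "\<iota> w = \<iota> (x - y)"
      using cu(1) pq(3) xy by (simp add: linear_diff[OF assms(3)])
    then have "w = x - y" using assms(4) by (simp add: inj_eq)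
    moreover have "x \<in> \<iota> -` (convex_cone_gen \<Lambda> + U)" "y \<in> \<iota> -` (convex_cone_gen \<Lambda> + U)"
      using W xy by simp_all
    ultimately show ?thesis by (simp add: span_diff span_base)
  qed
  then show ?thesis by blast
qed

text \<open>Evaluating at \<open>0\<close> identifies the constant of the affine map, so the increments are the values
  of its linear part; finite dimension makes that part bounded.\<close>

lemma linear_extension_affine_increment:
  fixes f :: "'v::euclidean_space \<Rightarrow> 'y::real_normed_vector"
  assumes "affine_map_on X f" "0 \<in> X" "span X = UNIV" "v \<in> X"
  shows "blinfun_apply (linear_extension X (\<lambda>v. f v - f 0)) v = f v - f 0"
proof -
  obtain c T where T: "linear T" "\<And>v. v \<in> X \<Longrightarrow> f v = c + T v"
    using assms(1) unfolding affine_map_on_def by blast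
  have increment: "blinfun_apply (Blinfun T) v = f v - f 0" if "v \<in> X" for v
    using that T assms(2)
    by (simp add: bounded_linear_Blinfun_apply linear_conv_bounded_linear[symmetric] linear_0)
  then have "linear_extension X (\<lambda>v. f v - f 0) = Blinfun T"
    by (intro linear_extension_eq[OF assms(3)])
  with increment[OF assms(4)] show ?thesis by simp
qed

lemma range_blinfun_subset_subspace:
  assumes "span X = UNIV" "subspace K" "\<And>v. v \<in> X \<Longrightarrow> blinfun_apply T v \<in> K"
  shows "range (blinfun_apply T) \<subseteq> K"
proof -
  have "range (blinfun_apply T) = span (blinfun_apply T ` X)"
    by (simp add: linear_span_image[OF bounded_linear.linear[OF blinfun.bounded_linear_right]] assms(1))
  also have "\<dots> \<subseteq> K" using assms(2,3) by (intro span_minimal) auto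
  finally show ?thesis .
qed

theorem proposition4p6:
  fixes A :: "'h::{real_inner, complete_space} \<Rightarrow> 'h"
    and D :: "'h set"
    and \<alpha> :: "'h \<Rightarrow> 'h"
    and \<beta> :: "'h \<Rightarrow> 'h"
    and \<sigma> :: "'h \<Rightarrow> 'h ^ 'n"
    and \<Lambda> \<CC> U V W I dI G :: "'h set"
    and \<iota> :: "'v::euclidean_space \<Rightarrow> 'h"
    and \<sigma>2 :: "'h \<Rightarrow> 'v \<Rightarrow>\<^sub>L 'v"
    and S :: "('v \<Rightarrow>\<^sub>L 'v) \<Rightarrow>\<^sub>L 'h"
    and R K :: "('v \<Rightarrow>\<^sub>L 'v) set"
    and L :: "('v \<Rightarrow>\<^sub>L 'v \<Rightarrow>\<^sub>L 'v) set"
  defines "\<beta> \<equiv> (\<lambda>h. A h + \<alpha> h)"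
    and "\<CC> \<equiv> convex_cone_gen \<Lambda>"
    and "V \<equiv> span \<Lambda> + U"
    and "W \<equiv> \<CC> + U"
    and "G \<equiv> closure (span dI)"
    and "\<sigma>2 \<equiv> (\<lambda>h. square (to_V \<iota> (\<sigma> h)))"
    and "R \<equiv> span (\<sigma>2 ` I)"
    and "K \<equiv> (blinfun_apply S -` V) \<inter> R"
    and "L \<equiv> {T. range (blinfun_apply T) \<subseteq> K}"
  assumes separable: "separable_space (euclidean :: 'h topology)"
    and generator: "generates_C0_semigroup D A"
    and cont: "continuous_on UNIV \<alpha>" "continuous_on UNIV \<sigma>"
    and cone: "finite \<Lambda>" "independent \<Lambda>" "\<forall>l\<in>\<Lambda>. norm l = 1"
    and U: "subspace U" "\<exists>B. finite B \<and> U = span B"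
    and CU: "span \<Lambda> \<inter> U = {0}"
    and V: "V_inclusion \<Lambda> U \<iota>"
    and I: "I \<noteq> {}" "direct_sum I dI W"
    and GV: "direct_sum UNIV G V"
    and \<sigma>V: "\<forall>h k. \<sigma> h $ k \<in> V"
    and lipschitz: "\<exists>M. M-lipschitz_on UNIV \<sigma>2"
    and drift: "\<forall>h. \<alpha> h = blinfun_apply S (\<sigma>2 h)" "range (blinfun_apply S) \<subseteq> D"
    and ID: "I \<subseteq> D"
    and \<beta>V: "\<forall>g\<in>dI. \<forall>v\<in>W. \<beta> (g + v) - \<beta> g \<in> V"
  shows "(\<forall>v\<in>W. constant_modulo (\<lambda>g. \<sigma>2 (g + v) - \<sigma>2 g) dI K) \<and>
    ((\<forall>g\<in>dI. square_affine_on (\<iota> -` W) (\<lambda>v. to_V \<iota> (\<sigma> (g + \<iota> v)))) \<longrightarrow>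
      constant_modulo
        (\<lambda>g. linear_extension (\<iota> -` W) (\<lambda>v. \<sigma>2 (g + \<iota> v) - \<sigma>2 g)) dI L)"
proof -
  have lin: "linear \<iota>" and inj: "inj \<iota>" and range: "range \<iota> = V"
    using V unfolding V_inclusion_def V_def by auto
  have subV: "subspace V"
    unfolding range[symmetric] by (rule linear_subspace_image[OF lin subspace_UNIV])
  have subK: "subspace K"
    unfolding K_def R_def
    by (intro subspace_inter subspace_span
        linear_subspace_vimage[OF bounded_linear.linear[OF blinfun.bounded_linear_right] subV])
  have W0: "0 \<in> W"
    unfolding W_def \<CC>_def
    using set_plus_intro[OF zero_in_convex_cone_gen subspace_0[OF U(1)]] by simp
  have in_I: "g + v \<in> I" if "g \<in> dI" "v \<in> W" for g v
    using I(2) that unfolding direct_sum_def bij_betw_def by force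
  (* As 0 belongs to W, the points of dI themselves lie in I. *)
  have in_D: "g \<in> D" "g + v \<in> D" if "g \<in> dI" "v \<in> W" for g v
    using in_I[OF that(1) W0] in_I[OF that] ID by auto
  have in_R: "\<sigma>2 (g + v) - \<sigma>2 g \<in> R" if "g \<in> dI" "v \<in> W" for g v
    unfolding R_def using in_I[OF that(1) W0] in_I[OF that]
    by (intro span_diff span_base imageI) auto
  have part1: "(\<sigma>2 (g1 + v) - \<sigma>2 g1) - (\<sigma>2 (g2 + v) - \<sigma>2 g2) \<in> K"
    if g: "g1 \<in> dI" "g2 \<in> dI" and v: "v \<in> W" for g1 g2 v
  proof -
    have increment_A: "A (g1 + v) - A g1 = A (g2 + v) - A g2"
      using generator_increment_eq[OF generator] in_D g v by blast
    have "blinfun_apply S ((\<sigma>2 (g1 + v) - \<sigma>2 g1) - (\<sigma>2 (g2 + v) - \<sigma>2 g2)) =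
        (\<alpha> (g1 + v) - \<alpha> g1) - (\<alpha> (g2 + v) - \<alpha> g2)"
      by (simp add: drift(1) blinfun.diff_right)
    also have "\<dots> = (\<beta> (g1 + v) - \<beta> g1) - (\<beta> (g2 + v) - \<beta> g2)"
      using increment_A by (simp add: \<beta>_def algebra_simps)
    also have "\<dots> \<in> V" using subspace_diff[OF subV] \<beta>V g v by blast
    finally show ?thesis
      using span_diff[OF in_R[OF g(1) v, unfolded R_def] in_R[OF g(2) v, unfolded R_def]]
      by (simp add: K_def R_def)
  qed
  have part2: "constant_modulo
      (\<lambda>g. linear_extension (\<iota> -` W) (\<lambda>v. \<sigma>2 (g + \<iota> v) - \<sigma>2 g)) dI L"
    if sq: "\<forall>g\<in>dI. square_affine_on (\<iota> -` W) (\<lambda>v. to_V \<iota> (\<sigma> (g + \<iota> v)))"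
  proof -
    let ?T = "\<lambda>g. linear_extension (\<iota> -` W) (\<lambda>v. \<sigma>2 (g + \<iota> v) - \<sigma>2 g)"
    have spanX: "span (\<iota> -` W) = UNIV"
      unfolding W_def \<CC>_def
      using cone(1) U(1) lin inj range[unfolded V_def] by (rule span_vimage_cone_plus_subspace)
    have ext: "blinfun_apply (?T g) v = \<sigma>2 (g + \<iota> v) - \<sigma>2 g"
      if "g \<in> dI" "v \<in> \<iota> -` W" for g v
      using linear_extension_affine_increment[of "\<iota> -` W" "\<lambda>v. \<sigma>2 (g + \<iota> v)" v]
        sq that spanX W0
      by (simp add: square_affine_on_def \<sigma>2_def linear_0[OF lin])
    have "?T g1 - ?T g2 \<in> L" if "g1 \<in> dI" "g2 \<in> dI" for g1 g2
      unfolding L_def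
      by (rule CollectI, rule range_blinfun_subset_subspace[OF spanX subK])
        (simp add: blinfun.diff_left ext that part1)
    then show ?thesis unfolding constant_modulo_def by blast
  qed
  show ?thesis using part1 part2 unfolding constant_modulo_def by blast
qed

end
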